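(* Let $G$ be a connected infinite graph. Then $D'(G) \leq D(G)+1$, where $D(G)$ is the distinguishing number and $D'(G)$ is the distinguishing index of $G$.
   Context: Graphs are simple and undirected; a graph is infinite if it has infinitely many vertices (no countability or local finiteness is assumed). An automorphism $\varphi$ of $G$ preserves a vertex colouring $c$ if $c(\varphi(v))=c(v)$ for all vertices $v$, and preserves an edge colouring $c$ if $c(\varphi(x)\varphi(y))=c(xy)$ for all edges $xy$. The distinguishing number $D(G)$ is the least cardinal number of colours in a (not necessarily proper) vertex colouring of $G$ that is preserved only by the trivial automorphism. The distinguishing index $D'(G)$ is the least cardinal number of colours in a (not necessarily proper) edge colouring of $G$ that is preserved only by the trivial automorphism. These invariants may be infinite cardinals. *)

theory Defs
  imports Main
begin

unbundle cardinal_syntax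

section \<open>Simple undirected graphs\<close>

definition simple_graph :: "'a set \<Rightarrow> 'a set set \<Rightarrow> bool" where
  "simple_graph V E \<longleftrightarrow> (\<forall>e\<in>E. \<exists>x\<in>V. \<exists>y\<in>V. x \<noteq> y \<and> e = {x, y})"

definition connected_graph :: "'a set \<Rightarrow> 'a set set \<Rightarrow> bool" where
  "connected_graph V E \<longleftrightarrow> V \<noteq> {} \<and> (\<forall>x\<in>V. \<forall>y\<in>V. (x, y) \<in> {(u, v). {u, v} \<in> E}\<^sup>*)"

text \<open>The values of an automorphism outside \<open>V\<close> are irrelevant.\<close>

definition automorphism :: "'a set \<Rightarrow> 'a set set \<Rightarrow> ('a \<Rightarrow> 'a) \<Rightarrow> bool" where
  "automorphism V E \<phi> \<longleftrightarrow>
     bij_betw \<phi> V V \<and> (\<forall>x\<in>V. \<forall>y\<in>V. {\<phi> x, \<phi> y} \<in> E \<longleftrightarrow> {x, y} \<in> E)"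

definition trivial_on :: "'a set \<Rightarrow> ('a \<Rightarrow> 'a) \<Rightarrow> bool" where
  "trivial_on V \<phi> \<longleftrightarrow> (\<forall>v\<in>V. \<phi> v = v)"


section \<open>Distinguishing colourings\<close>

definition preserves_vertex_colouring :: "'a set \<Rightarrow> ('a \<Rightarrow> 'c) \<Rightarrow> ('a \<Rightarrow> 'a) \<Rightarrow> bool" where
  "preserves_vertex_colouring V c \<phi> \<longleftrightarrow> (\<forall>v\<in>V. c (\<phi> v) = c v)"

definition preserves_edge_colouring :: "'a set set \<Rightarrow> ('a set \<Rightarrow> 'c) \<Rightarrow> ('a \<Rightarrow> 'a) \<Rightarrow> bool" where
  "preserves_edge_colouring E c \<phi> \<longleftrightarrow> (\<forall>x y. {x, y} \<in> E \<longrightarrow> c {\<phi> x, \<phi> y} = c {x, y})"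

definition distinguishing_vertex_colouring ::
    "'a set \<Rightarrow> 'a set set \<Rightarrow> ('a \<Rightarrow> 'c) \<Rightarrow> bool" where
  "distinguishing_vertex_colouring V E c \<longleftrightarrow>
     (\<forall>\<phi>. automorphism V E \<phi> \<and> preserves_vertex_colouring V c \<phi> \<longrightarrow> trivial_on V \<phi>)"

definition distinguishing_edge_colouring ::
    "'a set \<Rightarrow> 'a set set \<Rightarrow> ('a set \<Rightarrow> 'c) \<Rightarrow> bool" where
  "distinguishing_edge_colouring V E c \<longleftrightarrow>
     (\<forall>\<phi>. automorphism V E \<phi> \<and> preserves_edge_colouring E c \<phi> \<longrightarrow> trivial_on V \<phi>)"


section \<open>Distinguishing number and distinguishing index\<close>

text \<open>The least cardinality of a member of a nonempty family of sets; on the empty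
  family the value is unspecified.\<close>

definition least_card :: "'c set set \<Rightarrow> 'c rel" where
  "least_card K = |SOME C. C \<in> K \<and> (\<forall>C'\<in>K. |C| \<le>o |C'| )|"

text \<open>Both invariants are cardinals in the sense of \<^const>\<open>Card_order\<close>. The colours are
  taken from the type of vertices, respectively of sets of vertices. This loses nothing:
  by the lemmas below, the values are least among colourings with colours of any type.\<close>

definition distinguishing_number :: "'a set \<Rightarrow> 'a set set \<Rightarrow> 'a rel" where
  "distinguishing_number V E =
     least_card {C. \<exists>c. c ` V \<subseteq> C \<and> distinguishing_vertex_colouring V E c}"

definition distinguishing_index :: "'a set \<Rightarrow> 'a set set \<Rightarrow> 'a set rel" where
  "distinguishing_index V E =
     least_card {C. \<exists>c. c ` E \<subseteq> C \<and> distinguishing_edge_colouring V E c}"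

lemma least_card_attained:
  assumes "K \<noteq> {}"
  obtains C where "C \<in> K" "least_card K = |C|" "\<And>C'. C' \<in> K \<Longrightarrow> least_card K \<le>o |C'|"
proof -
  have "\<exists>r \<in> card_of ` K. \<forall>r' \<in> card_of ` K. r \<le>o r'"
    by (rule exists_minim_Card_order) (use assms in \<open>auto intro: card_of_Card_order\<close>)
  then have "\<exists>C. C \<in> K \<and> (\<forall>C'\<in>K. |C| \<le>o |C'| )"
    by blast
  from someI_ex[OF this] show thesis
    by (intro that[of "SOME C. C \<in> K \<and> (\<forall>C'\<in>K. |C| \<le>o |C'| )"]) (auto simp: least_card_def)
qed

lemma least_card_le: "C \<in> K \<Longrightarrow> least_card K \<le>o |C|"
  by (rule least_card_attained[of K]) auto

lemma distinguishing_number_attained: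
  obtains c :: "'a \<Rightarrow> 'a" and C where
    "distinguishing_vertex_colouring V E c" "c ` V \<subseteq> C" "distinguishing_number V E = |C|"
proof -
  have "distinguishing_vertex_colouring V E (\<lambda>v. v)"
    by (auto simp: distinguishing_vertex_colouring_def preserves_vertex_colouring_def
        trivial_on_def)
  then have "{C :: 'a set. \<exists>c. c ` V \<subseteq> C \<and> distinguishing_vertex_colouring V E c} \<noteq> {}"
    by blast
  then show thesis
    by (rule least_card_attained) (use that in \<open>auto simp: distinguishing_number_def\<close>)
qed

lemma distinguishing_number_least:
  fixes c :: "'a \<Rightarrow> 'c"
  assumes "distinguishing_vertex_colouring V E c" and "c ` V \<subseteq> C"
  shows "distinguishing_number V E \<le>o |C|"
proof -
  define d where "d = inv_into V c \<circ> c"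
  have eq: "d u = d v \<longleftrightarrow> c u = c v" if "u \<in> V" "v \<in> V" for u v
    using that unfolding d_def comp_def by (metis f_inv_into_f imageI)
  have "distinguishing_vertex_colouring V E d"
    unfolding distinguishing_vertex_colouring_def
  proof (intro allI impI, elim conjE)
    fix \<phi> assume aut: "automorphism V E \<phi>" and pres: "preserves_vertex_colouring V d \<phi>"
    have "c (\<phi> v) = c v" if "v \<in> V" for v
    proof -
      have "\<phi> v \<in> V"
        using aut that bij_betwE unfolding automorphism_def by blast
      then show ?thesis
        using eq pres that unfolding preserves_vertex_colouring_def by blast
    qed
    then show "trivial_on V \<phi>"
      using assms(1) aut
      unfolding distinguishing_vertex_colouring_def preserves_vertex_colouring_def by blast
  qed
  then have mem: "d ` V \<in> {C. \<exists>c. c ` V \<subseteq> C \<and> distinguishing_vertex_colouring V E c}"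
    by blast
  have "distinguishing_number V E \<le>o |d ` V|"
    unfolding distinguishing_number_def using mem by (rule least_card_le)
  also have "|d ` V| \<le>o |c ` V|"
    unfolding d_def image_comp[symmetric] by (rule card_of_image)
  also have "|c ` V| \<le>o |C|"
    using assms(2) by (rule card_of_mono1)
  finally (ordLeq_transitive) show ?thesis .
qed

lemma distinguishing_index_least:
  fixes c :: "'a set \<Rightarrow> 'c"
  assumes "simple_graph V E" and "distinguishing_edge_colouring V E c" and "c ` E \<subseteq> C"
  shows "distinguishing_index V E \<le>o |C|"
proof -
  define d where "d = inv_into E c \<circ> c"
  have eq: "d e = d f \<longleftrightarrow> c e = c f" if "e \<in> E" "f \<in> E" for e f
    using that unfolding d_def comp_def by (metis f_inv_into_f imageI)
  have "distinguishing_edge_colouring V E d"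
    unfolding distinguishing_edge_colouring_def
  proof (intro allI impI, elim conjE)
    fix \<phi> assume aut: "automorphism V E \<phi>" and pres: "preserves_edge_colouring E d \<phi>"
    have "c {\<phi> x, \<phi> y} = c {x, y}" if xy: "{x, y} \<in> E" for x y
    proof -
      obtain a b where "a \<in> V" "b \<in> V" "{x, y} = {a, b}"
        using assms(1) xy unfolding simple_graph_def by blast
      then have "x \<in> V" "y \<in> V"
        by (auto simp: doubleton_eq_iff)
      then have "{\<phi> x, \<phi> y} \<in> E"
        using aut xy unfolding automorphism_def by blast
      then show ?thesis
        using eq pres xy unfolding preserves_edge_colouring_def by blast
    qed
    then show "trivial_on V \<phi>"
      using assms(2) aut
      unfolding distinguishing_edge_colouring_def preserves_edge_colouring_def by blast
  qed
  then have mem: "d ` E \<in> {C. \<exists>c. c ` E \<subseteq> C \<and> distinguishing_edge_colouring V E c}"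
    by blast
  have "distinguishing_index V E \<le>o |d ` E|"
    unfolding distinguishing_index_def using mem by (rule least_card_le)
  also have "|d ` E| \<le>o |c ` E|"
    unfolding d_def image_comp[symmetric] by (rule card_of_image)
  also have "|c ` E| \<le>o |C|"
    using assms(3) by (rule card_of_mono1)
  finally (ordLeq_transitive) show ?thesis .
qed

text \<open>In a connected infinite graph distinct vertices are incident with different sets of
  edges, so colouring each edge by itself is distinguishing.\<close>

lemma distinguishing_index_attained:
  assumes "simple_graph V E" and "connected_graph V E" and "infinite V"
  obtains c :: "'a set \<Rightarrow> 'a set" and C where
    "distinguishing_edge_colouring V E c" "c ` E \<subseteq> C" "distinguishing_index V E = |C|"
proof -
  have "distinguishing_edge_colouring V E (\<lambda>e. e)"
    unfolding distinguishing_edge_colouring_def trivial_on_def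
  proof (intro allI impI ballI, elim conjE, rule ccontr)
    fix \<phi> v
    assume pres: "preserves_edge_colouring E (\<lambda>e. e) \<phi>" and v: "v \<in> V" and ne: "\<phi> v \<noteq> v"
    have fix_edge: "{\<phi> x, \<phi> y} = {x, y}" if "{x, y} \<in> E" for x y
      using pres that unfolding preserves_edge_colouring_def by blast
    have nbr_v: "y = \<phi> v" if "{v, y} \<in> E" for y
      using fix_edge[OF that] ne unfolding doubleton_eq_iff by metis
    have nbr_w: "y = v" if "{\<phi> v, y} \<in> E" "{v, \<phi> v} \<in> E" for y
      using fix_edge[OF that(1)] fix_edge[OF that(2)] ne unfolding doubleton_eq_iff by metis
    have "x \<in> {v, \<phi> v}" if "(v, x) \<in> {(u, v). {u, v} \<in> E}\<^sup>*" for x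
      using that
    proof induction
      case (step y z)
      then have yz: "{y, z} \<in> E" by simp
      show ?case
      proof (cases "y = v")
        case True
        with nbr_v yz show ?thesis by blast
      next
        case False
        with step.IH have y: "y = \<phi> v" by simp
        from step.hyps(1) False have "\<exists>u. {v, u} \<in> E"
          by (auto elim: converse_rtranclE)
        with nbr_v have "{v, \<phi> v} \<in> E" by metis
        with nbr_w yz y show ?thesis by blast
      qed
    qed simp
    then have "V \<subseteq> {v, \<phi> v}"
      using assms(2) v unfolding connected_graph_def by blast
    with assms(3) show False
      by (meson finite.emptyI finite.insertI finite_subset)
  qed
  then have "{C :: 'a set set. \<exists>c. c ` E \<subseteq> C \<and> distinguishing_edge_colouring V E c} \<noteq> {}"
    by blast
  then show thesis
    by (rule least_card_attained) (use that in \<open>auto simp: distinguishing_index_def\<close>)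
qed

end

theory Submission
  imports Defs
begin

text \<open>
  Let \<open>c\<close> be a distinguishing vertex colouring. Fix a root \<open>r\<close> and colour every edge with the
  colour of its end further away from \<open>r\<close>. An automorphism that fixes \<open>r\<close> and preserves this
  edge colouring preserves distances from \<open>r\<close>, hence it preserves \<open>c\<close> on \<open>V - {r}\<close> and is
  trivial. It remains to force the root to be fixed, at the cost of one more colour.

  If two neighbours of \<open>r\<close> share a colour \<open>a\<close>, use the new colour instead of \<open>a\<close> on the edges
  at \<open>r\<close>: the edges with the new colour then form a star with at least two edges centred at
  \<open>r\<close>. If there is no such \<open>r\<close> and \<open>c\<close> uses finitely many colours, then the graph is locally
  finite and so contains a ray, which is fixed pointwise once all its edges receive the new
  colour. If \<open>c\<close> uses infinitely many colours, the edges at \<open>r\<close> can have a palette of their own.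
\<close>

section \<open>Elementary facts on automorphisms and edges\<close>

lemma automorphism_in: "automorphism V E \<phi> \<Longrightarrow> x \<in> V \<Longrightarrow> \<phi> x \<in> V"
  unfolding automorphism_def by (meson bij_betwE)

lemma automorphism_inj: "automorphism V E \<phi> \<Longrightarrow> x \<in> V \<Longrightarrow> y \<in> V \<Longrightarrow> \<phi> x = \<phi> y \<longleftrightarrow> x = y"
  unfolding automorphism_def bij_betw_def inj_on_def by blast

lemma automorphism_surj:
  assumes "automorphism V E \<phi>" "y \<in> V"
  obtains x where "x \<in> V" "\<phi> x = y"
proof -
  have "y \<in> \<phi> ` V"
    using assms unfolding automorphism_def bij_betw_def by simp
  then show thesis
    using that by blast
qed

lemma automorphism_edge:
  "automorphism V E \<phi> \<Longrightarrow> x \<in> V \<Longrightarrow> y \<in> V \<Longrightarrow> {\<phi> x, \<phi> y} \<in> E \<longleftrightarrow> {x, y} \<in> E"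
  unfolding automorphism_def by blast

lemma simple_graph_edge:
  assumes "simple_graph V E" "{x, y} \<in> E"
  shows "x \<in> V" "y \<in> V" "x \<noteq> y"
  using assms unfolding simple_graph_def by (force simp: doubleton_eq_iff)+

section \<open>Distance layers from a root\<close>

locale rooted_graph =
  fixes V :: "'a set" and E :: "'a set set" and r :: 'a
  assumes simple: "simple_graph V E"
    and connected: "connected_graph V E"
    and root_in: "r \<in> V"
begin

lemmas edge_ends = simple_graph_edge[OF simple]

definition adj :: "('a \<times> 'a) set" where
  "adj = {(u, v). {u, v} \<in> E}"

definition depth :: "'a \<Rightarrow> nat" where
  "depth v = (LEAST n. (r, v) \<in> adj ^^ n)"

text \<open>Orients every edge between consecutive layers, so a vertex may have several parents.
  Unlike a spanning tree, this is invariant under all automorphisms fixing \<open>r\<close>.\<close>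

definition child :: "('a \<times> 'a) set" where
  "child = {(x, y). {x, y} \<in> E \<and> depth y = Suc (depth x)}"

text \<open>Between vertices of equal depth the choice is arbitrary; there only membership in
  \<open>V\<close> is used, so that the colour stays in its palette.\<close>

definition far_end :: "'a set \<Rightarrow> 'a" where
  "far_end e = (SOME v. v \<in> e \<and> (\<forall>u\<in>e. depth u \<le> depth v))"

lemma depth_root [simp]: "depth r = 0"
  unfolding depth_def by (rule Least_eq_0) simp

lemma walk_depth:
  assumes "v \<in> V"
  shows "(r, v) \<in> adj ^^ depth v"
proof -
  have "(r, v) \<in> adj\<^sup>*"
    using connected root_in assms unfolding connected_graph_def adj_def by blast
  then obtain n where "(r, v) \<in> adj ^^ n"
    using rtrancl_imp_relpow by blast
  then show ?thesis
    unfolding depth_def by (rule LeastI)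
qed

lemma depth_le: "(r, v) \<in> adj ^^ n \<Longrightarrow> depth v \<le> n"
  unfolding depth_def by (rule Least_le)

lemma depth_eq_0_iff: "v \<in> V \<Longrightarrow> depth v = 0 \<longleftrightarrow> v = r"
  using walk_depth[of v] by auto

text \<open>The last step of a shortest walk from \<open>r\<close> comes from such an
  \<open>x\<close>: a shorter walk to \<open>x\<close> would shorten the walk to
  \<open>v\<close>.\<close>

lemma parent_ex:
  assumes "v \<in> V" "v \<noteq> r"
  obtains x where "(x, v) \<in> child"
proof -
  obtain n where n: "depth v = Suc n"
    using assms depth_eq_0_iff not0_implies_Suc by blast
  obtain x where x: "(r, x) \<in> adj ^^ n" "(x, v) \<in> adj"
    using walk_depth[OF assms(1)] n by auto
  have xV: "x \<in> V"
    using x(2) edge_ends unfolding adj_def by blast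
  have "(r, v) \<in> adj ^^ Suc (depth x)"
    using walk_depth[OF xV] x(2) by auto
  then have "Suc n \<le> Suc (depth x)"
    using depth_le n by metis
  moreover have "depth x \<le> n"
    using depth_le x(1) by blast
  ultimately have "(x, v) \<in> child"
    using x(2) n unfolding child_def adj_def by simp
  then show thesis by (rule that)
qed

lemma descendant_of_root: "v \<in> V \<Longrightarrow> (r, v) \<in> child\<^sup>*"
proof (induction "depth v" arbitrary: v)
  case 0
  then show ?case using depth_eq_0_iff by simp
next
  case (Suc n)
  then have "v \<noteq> r" by auto
  then obtain x where x: "(x, v) \<in> child"
    using parent_ex Suc.prems by blast
  then have "x \<in> V" "n = depth x"
    using edge_ends Suc.hyps(2) unfolding child_def by auto
  then have "(r, x) \<in> child\<^sup>*"
    using Suc.hyps(1) by blast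
  then show ?case
    using x by (rule rtrancl_into_rtrancl)
qed

lemma far_end_child:
  assumes "(x, y) \<in> child"
  shows "far_end {x, y} = y"
  unfolding far_end_def by (rule some_equality) (use assms in \<open>auto simp: child_def\<close>)

lemma far_end_in:
  assumes "e \<in> E"
  shows "far_end e \<in> V"
proof -
  obtain x y where e: "e = {x, y}" "x \<in> V" "y \<in> V"
    using simple assms unfolding simple_graph_def by blast
  have "\<exists>v. v \<in> e \<and> (\<forall>u\<in>e. depth u \<le> depth v)"
    unfolding e(1) using linear by auto
  from someI_ex[OF this] show ?thesis
    using e unfolding far_end_def by auto
qed

section \<open>Automorphisms that fix the root\<close>

text \<open>Walks from \<open>r\<close> map to walks from \<open>r\<close>, and surjectivity
  supplies preimages for the converse. The equivalence for every \<open>n\<close> makes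
  \<open>depth\<close> invariant.\<close>

lemma walk_automorphism:
  assumes \<phi>: "automorphism V E \<phi>" "\<phi> r = r"
  shows "v \<in> V \<Longrightarrow> (r, \<phi> v) \<in> adj ^^ n \<longleftrightarrow> (r, v) \<in> adj ^^ n"
proof (induction n arbitrary: v)
  case 0
  then show ?case
    using automorphism_inj[OF \<phi>(1) root_in] \<phi>(2) by auto
next
  case (Suc n)
  show ?case
  proof
    assume "(r, \<phi> v) \<in> adj ^^ Suc n"
    then obtain y where y: "(r, y) \<in> adj ^^ n" "(y, \<phi> v) \<in> adj" by auto
    then obtain x where x: "x \<in> V" "\<phi> x = y"
      using edge_ends automorphism_surj[OF \<phi>(1)] unfolding adj_def by blast
    then have "(r, x) \<in> adj ^^ n" "(x, v) \<in> adj"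
      using y Suc.IH automorphism_edge[OF \<phi>(1)] Suc.prems unfolding adj_def by auto
    then show "(r, v) \<in> adj ^^ Suc n" by auto
  next
    assume "(r, v) \<in> adj ^^ Suc n"
    then obtain x where x: "(r, x) \<in> adj ^^ n" "(x, v) \<in> adj" by auto
    then have "x \<in> V"
      using edge_ends unfolding adj_def by blast
    then have "(r, \<phi> x) \<in> adj ^^ n" "(\<phi> x, \<phi> v) \<in> adj"
      using x Suc.IH automorphism_edge[OF \<phi>(1)] Suc.prems unfolding adj_def by auto
    then show "(r, \<phi> v) \<in> adj ^^ Suc n" by auto
  qed
qed

lemma child_automorphism:
  assumes \<phi>: "automorphism V E \<phi>" "\<phi> r = r" and xy: "(x, y) \<in> child"
  shows "(\<phi> x, \<phi> y) \<in> child"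
proof -
  have "x \<in> V" "y \<in> V"
    using xy edge_ends unfolding child_def by auto
  then show ?thesis
    using xy automorphism_edge[OF \<phi>(1)] walk_automorphism[OF \<phi>]
    unfolding child_def depth_def by simp
qed

text \<open>If \<open>v\<close> is moved, compare the edge from a parent \<open>x\<close> with its
  image: both encode the colour of their far end by the same injection, as
  \<open>\<phi> x = r\<close> iff \<open>x = r\<close>. The Boolean allows a separate code at the
  root; asking for the formula only at moved \<open>v\<close> leaves room for a recoloured
  ray.\<close>

lemma trivial_if_root_fixed:
  assumes \<phi>: "automorphism V E \<phi>" "\<phi> r = r" "preserves_edge_colouring E f \<phi>"
    and c: "distinguishing_vertex_colouring V E c"
    and g: "\<And>b. inj_on (g b) (c ` V)"
    and f: "\<And>x v. (x, v) \<in> child \<Longrightarrow> \<phi> v \<noteq> v \<Longrightarrow> f {x, v} = g (x = r) (c v)"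
  shows "trivial_on V \<phi>"
proof -
  have "c (\<phi> v) = c v" if v: "v \<in> V" for v
  proof (cases "\<phi> v = v")
    case False
    then obtain x where x: "(x, v) \<in> child"
      using parent_ex v \<phi>(2) by metis
    have xV: "x \<in> V" and xv: "{x, v} \<in> E"
      using x edge_ends unfolding child_def by auto
    \<comment> \<open>The colour formula applies to the image edge only if its far end is moved as
      well.\<close>
    have "\<phi> (\<phi> v) \<noteq> \<phi> v"
      using False automorphism_inj[OF \<phi>(1)] automorphism_in[OF \<phi>(1)] v by blast
    then have "f {\<phi> x, \<phi> v} = g (\<phi> x = r) (c (\<phi> v))"
      using f child_automorphism[OF \<phi>(1,2) x] by blast
    moreover have "\<phi> x = r \<longleftrightarrow> x = r"
      using automorphism_inj[OF \<phi>(1) xV root_in] \<phi>(2) by simp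
    moreover have "f {\<phi> x, \<phi> v} = g (x = r) (c v)"
      using f[OF x False] \<phi>(3) xv unfolding preserves_edge_colouring_def by simp
    ultimately have "g (x = r) (c (\<phi> v)) = g (x = r) (c v)" by simp
    then show ?thesis
      using inj_onD[OF g] v automorphism_in[OF \<phi>(1) v] by blast
  qed simp
  then show ?thesis
    using c \<phi>(1)
    unfolding distinguishing_vertex_colouring_def preserves_vertex_colouring_def by blast
qed

section \<open>Fixing the root by a star\<close>

text \<open>The colours of the edges from \<open>r\<close> to \<open>s\<close> and \<open>t\<close>
  occur only at \<open>r\<close>, so the images of both edges contain \<open>r\<close>; but these
  images share only \<open>\<phi> r\<close>.\<close>

lemma distinguishing_star:
  assumes c: "distinguishing_vertex_colouring V E c"
    and g: "\<And>b. inj_on (g b) (c ` V)"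
    and s: "{r, s} \<in> E" "g True (c s) \<notin> g False ` c ` V"
    and t: "{r, t} \<in> E" "g True (c t) \<notin> g False ` c ` V"
    and st: "s \<noteq> t"
  shows "distinguishing_edge_colouring V E (\<lambda>e. g (r \<in> e) (c (far_end e)))"
    (is "distinguishing_edge_colouring V E ?f")
  unfolding distinguishing_edge_colouring_def
proof (intro allI impI, elim conjE)
  fix \<phi> assume \<phi>: "automorphism V E \<phi>" "preserves_edge_colouring E ?f \<phi>"
  have child_root: "(r, u) \<in> child" if u: "{r, u} \<in> E" for u
  proof -
    have "u \<in> V" "u \<noteq> r"
      using edge_ends[OF u] by auto
    moreover have "(r, u) \<in> adj ^^ 1"
      using u unfolding adj_def by simp
    ultimately have "depth u = 1"
      using depth_le depth_eq_0_iff by (metis le_antisym less_one not_le)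
    then show ?thesis
      using u unfolding child_def by simp
  qed
  have star: "r \<in> {\<phi> r, \<phi> u}" if u: "{r, u} \<in> E" "g True (c u) \<notin> g False ` c ` V" for u
  proof (rule ccontr)
    assume r: "r \<notin> {\<phi> r, \<phi> u}"
    have "{\<phi> r, \<phi> u} \<in> E"
      using u(1) edge_ends automorphism_edge[OF \<phi>(1)] by blast
    then have "?f {\<phi> r, \<phi> u} \<in> g False ` c ` V"
      using r far_end_in by simp
    moreover have "?f {\<phi> r, \<phi> u} = ?f {r, u}"
      using \<phi>(2) u(1) unfolding preserves_edge_colouring_def by blast
    moreover have "?f {r, u} = g True (c u)"
      using far_end_child[OF child_root[OF u(1)]] by simp
    ultimately show False
      using u(2) by simp
  qed
  have "\<phi> s \<noteq> \<phi> t"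
    using s(1) t(1) st edge_ends automorphism_inj[OF \<phi>(1)] by blast
  then have root: "\<phi> r = r"
    using star[OF s] star[OF t] by auto
  show "trivial_on V \<phi>"
  proof (rule trivial_if_root_fixed[OF \<phi>(1) root \<phi>(2) c g])
    fix x v assume xv: "(x, v) \<in> child"
    \<comment> \<open>Hence the edge contains \<open>r\<close> exactly when
      \<open>x = r\<close>.\<close>
    then have "v \<noteq> r"
      unfolding child_def by auto
    then show "?f {x, v} = g (x = r) (c v)"
      using far_end_child[OF xv] by (auto simp: eq_commute)
  qed
qed

section \<open>Rays: existence, rigidity and the colouring built on them\<close>

text \<open>Koenig's lemma: keep passing to a child with infinitely many descendants. Depth strictly
  increases along the way, which gives injectivity.\<close>

lemma ray_ex:
  assumes inf: "infinite V" and fin: "\<And>v. v \<in> V \<Longrightarrow> finite {u. {v, u} \<in> E}"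
  obtains p :: "nat \<Rightarrow> 'a" where "inj p" "\<And>n. {p n, p (Suc n)} \<in> E"
proof -
  define desc where "desc v = child\<^sup>* `` {v}" for v
  have step: "\<exists>y. (y \<in> V \<and> infinite (desc y)) \<and> (x, y) \<in> child"
    if x: "x \<in> V \<and> infinite (desc x)" for x
  proof (rule ccontr)
    assume none: "\<not> ?thesis"
    have "child `` {x} \<subseteq> {u. {x, u} \<in> E}"
      unfolding child_def by blast
    then have "finite (child `` {x})"
      using fin x finite_subset by blast
    moreover have "finite (desc y)" if "y \<in> child `` {x}" for y
      using none that edge_ends unfolding child_def by blast
    ultimately have "finite (insert x (\<Union>y\<in>child `` {x}. desc y))"
      by blast
    moreover have "desc x \<subseteq> insert x (\<Union>y\<in>child `` {x}. desc y)"
      unfolding desc_def by (auto elim: converse_rtranclE)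
    ultimately show False
      using x finite_subset by blast
  qed
  have "V \<subseteq> desc r"
    using descendant_of_root unfolding desc_def by blast
  then have "r \<in> V \<and> infinite (desc r)"
    using root_in inf finite_subset by blast
  then obtain p where "\<forall>n. (p n \<in> V \<and> infinite (desc (p n))) \<and> (p n, p (Suc n)) \<in> child"
    using dependent_nat_choice[of "\<lambda>_ x. x \<in> V \<and> infinite (desc x)" "\<lambda>_ x y. (x, y) \<in> child"]
      step by blast
  then have p: "(p n, p (Suc n)) \<in> child" for n
    by blast
  have "strict_mono (\<lambda>n. depth (p n))"
    using p unfolding strict_mono_Suc_iff child_def by auto
  then have "inj p"
    by (metis injI strict_mono_eq)
  then show thesis
    using that p unfolding child_def by blast
qed

end

text \<open>\<open>\<phi>\<close> permutes the ray edges, and \<open>p 0\<close> is the only ray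
  vertex on just one of them, so it is fixed. From there on, injectivity rules out turning
  back.\<close>

lemma ray_fixed:
  assumes simple: "simple_graph V E"
    and inj: "inj p" and p: "\<And>n. {p n, p (Suc n)} \<in> E"
    and \<phi>: "automorphism V E \<phi>"
    and R: "\<And>x y. {x, y} \<in> E \<Longrightarrow>
      {\<phi> x, \<phi> y} \<in> range (\<lambda>n. {p n, p (Suc n)}) \<longleftrightarrow> {x, y} \<in> range (\<lambda>n. {p n, p (Suc n)})"
  shows "\<phi> (p n) = p n"
proof -
  let ?R = "range (\<lambda>n. {p n, p (Suc n)})"
  have pV: "p n \<in> V" for n
    using simple_graph_edge[OF simple p] by blast
  have p_eq: "p m = p n \<longleftrightarrow> m = n" for m n
    using inj by (simp add: inj_eq)
  have ray_nbr: "\<exists>m. y = p m \<and> (m = Suc n \<or> n = Suc m)" if "{p n, y} \<in> ?R" for n y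
    using that by (auto simp: doubleton_eq_iff p_eq)
  have image: "{\<phi> (p n), \<phi> (p (Suc n))} \<in> ?R" for n
    using R[OF p] by blast
  have "\<phi> (p 0) \<in> range p"
    using image[of 0] by (auto simp: doubleton_eq_iff)
  then obtain j where j: "\<phi> (p 0) = p j" by blast
  have start: "\<phi> (p 0) = p 0"
  proof (rule ccontr)
    assume "\<phi> (p 0) \<noteq> p 0"
    then obtain i where i: "j = Suc i"
      using j not0_implies_Suc by metis
    \<comment> \<open>Ray neighbours of \<open>p j\<close> pull back to ray neighbours of
      \<open>p 0\<close>, and \<open>p 1\<close> is the only one. But \<open>p j\<close> with
      \<open>j > 0\<close> has two.\<close>
    have preimage: "p m = \<phi> (p 1)" if m: "{p j, p m} \<in> ?R" for m
    proof -
      obtain x where x: "x \<in> V" "\<phi> x = p m"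
        using automorphism_surj[OF \<phi> pV] .
      have "{\<phi> (p 0), \<phi> x} \<in> E"
        using m j x(2) p by auto
      then have "{p 0, x} \<in> E"
        using automorphism_edge[OF \<phi> pV x(1)] by blast
      moreover have "{\<phi> (p 0), \<phi> x} \<in> ?R"
        using m unfolding j x(2) .
      ultimately have "{p 0, x} \<in> ?R"
        using R[of "p 0" x] by simp
      then have "x = p 1"
        using ray_nbr[of 0 x] by auto
      then show ?thesis
        using x(2) by simp
    qed
    have "{p j, p (Suc j)} \<in> ?R" by blast
    moreover have "{p j, p i} \<in> ?R"
      unfolding i by (rule image_eqI[of _ _ i]) (simp_all add: insert_commute)
    ultimately have "p (Suc j) = p i"
      using preimage[of "Suc j"] preimage[of i] by simp
    then show False
      using i p_eq by simp
  qed
  show ?thesis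
  proof (induction n rule: less_induct)
    case (less n)
    show ?case
    proof (cases n)
      case 0
      with start show ?thesis by simp
    next
      case (Suc k)
      have "{p k, \<phi> (p n)} \<in> ?R"
        using image[of k] less[of k] Suc by simp
      then obtain m where m: "\<phi> (p n) = p m" "m = Suc k \<or> k = Suc m"
        using ray_nbr by blast
      have "k \<noteq> Suc m"
      proof
        assume "k = Suc m"
        then have "m < n" using Suc by simp
        then have "\<phi> (p n) = \<phi> (p m)"
          using less m(1) by simp
        then show False
          using automorphism_inj[OF \<phi> pV pV] p_eq \<open>m < n\<close> by simp
      qed
      with m Suc show ?thesis by simp
    qed
  qed
qed

text \<open>\<open>Inr ()\<close> marks exactly the ray edges, so the ray with its root
  \<open>p 0\<close> is fixed pointwise. An edge from a parent to a moved vertex is then off the ray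
  and still shows the colour of its far end.\<close>

lemma distinguishing_ray:
  assumes simple: "simple_graph V E" and connected: "connected_graph V E"
    and inj: "inj p" and p: "\<And>n. {p n, p (Suc n)} \<in> E"
    and c: "distinguishing_vertex_colouring V E c"
  defines "R \<equiv> range (\<lambda>n. {p n, p (Suc n)})"
  shows "distinguishing_edge_colouring V E
    (\<lambda>e. if e \<in> R then Inr () else Inl (c (rooted_graph.far_end E (p 0) e)))"
    (is "distinguishing_edge_colouring V E ?f")
  unfolding distinguishing_edge_colouring_def
proof (intro allI impI, elim conjE)
  fix \<phi> assume \<phi>: "automorphism V E \<phi>" "preserves_edge_colouring E ?f \<phi>"
  interpret rooted_graph V E "p 0"
    using simple connected p simple_graph_edge[OF simple] by unfold_locales auto
  have "{\<phi> x, \<phi> y} \<in> R \<longleftrightarrow> {x, y} \<in> R" if "{x, y} \<in> E" for x y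
  proof -
    have "?f {\<phi> x, \<phi> y} = ?f {x, y}"
      using \<phi>(2) that unfolding preserves_edge_colouring_def by blast
    then show ?thesis
      by (auto split: if_splits)
  qed
  then have fixed: "\<phi> (p n) = p n" for n
    unfolding R_def by (rule ray_fixed[OF simple inj p \<phi>(1)])
  show "trivial_on V \<phi>"
  proof (rule trivial_if_root_fixed[OF \<phi>(1) fixed \<phi>(2) c])
    show "inj_on Inl (c ` V)" by simp
  next
    fix x v assume xv: "(x, v) \<in> child" and "\<phi> v \<noteq> v"
    then have "{x, v} \<notin> R"
      using fixed unfolding R_def by (auto simp: doubleton_eq_iff)
    then show "?f {x, v} = Inl (c v)"
      using far_end_child[OF xv] by simp
  qed
qed

text \<open>Otherwise all degrees are at most one, so the graph is locally finite and contains a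
  ray, whose vertex \<open>p 1\<close> has two neighbours.\<close>

lemma vertex_of_degree_two_ex:
  assumes "simple_graph V E" "connected_graph V E" "infinite V"
  obtains r s t where "{r, s} \<in> E" "{r, t} \<in> E" "s \<noteq> t"
proof (rule ccontr)
  assume none: "\<not> thesis"
  have unique: "s = t" if "{r, s} \<in> E" "{r, t} \<in> E" for r s t
    using none \<open>\<And>r s t. \<lbrakk>{r, s} \<in> E; {r, t} \<in> E; s \<noteq> t\<rbrakk> \<Longrightarrow> thesis\<close> that by blast
  obtain p where p: "\<And>n::nat. {p n, p (Suc n)} \<in> E" "inj p"
  proof -
    obtain r where "r \<in> V"
      using assms(3) by fastforce
    then interpret rooted_graph V E r
      using assms by unfold_locales
    have "finite {u. {v, u} \<in> E}" for v
    proof (cases "{u. {v, u} \<in> E} = {}")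
      case False
      then obtain w where "{v, w} \<in> E" by blast
      then have "{u. {v, u} \<in> E} \<subseteq> {w}"
        using unique by blast
      then show ?thesis
        using finite_subset by blast
    qed simp
    then show thesis
      using ray_ex[OF assms(3)] that by blast
  qed
  have "{p 1, p 0} \<in> E" "{p 1, p 2} \<in> E"
    using p(1)[of 0] p(1)[of 1] by (simp_all add: insert_commute numeral_2_eq_2)
  then have "p 0 = p 2"
    by (rule unique)
  then show False
    using p(2) by (simp add: inj_eq)
qed

section \<open>The bound, by cases on repeated neighbour colours and on the size of the
  palette\<close>

theorem theorem1:
  fixes V :: "'a set" and E :: "'a set set"
  assumes "simple_graph V E" and "connected_graph V E" and "infinite V"
  shows "distinguishing_index V E \<le>o distinguishing_number V E +c cone"
proof -
  obtain c :: "'a \<Rightarrow> 'a" and C where c: "distinguishing_vertex_colouring V E c" "c ` V \<subseteq> C"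
    and D: "distinguishing_number V E = |C|"
    by (rule distinguishing_number_attained)
  have bound: "|C <+> {()}| = distinguishing_number V E +c cone"
    unfolding D csum_def cone_def by (simp add: Field_card_of)
  have rooted: "rooted_graph V E r" if "{r, s} \<in> E" for r s
    using assms simple_graph_edge[OF assms(1) that] by unfold_locales
  have colour_in: "c (rooted_graph.far_end E r e) \<in> C"
    if "rooted_graph V E r" "e \<in> E" for r e
    using c(2) rooted_graph.far_end_in[OF that] by blast
  consider
      (repeated) r s t where "{r, s} \<in> E" "{r, t} \<in> E" "s \<noteq> t" "c s = c t"
    | (infinite) "infinite C"
    | (finite) "finite C" "\<And>r. inj_on c {u. {r, u} \<in> E}"
    unfolding inj_on_def by blast
  then show ?thesis
  proof cases
    case repeated
    interpret rooted_graph V E r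
      using repeated(1) by (rule rooted)
    \<comment> \<open>Only \<open>c s\<close> is recoded at the root, to a colour that
      \<open>g False\<close> never takes; the other colours keep their codes, so
      \<open>g True\<close> stays injective.\<close>
    define g where "g b a = (if b \<and> a = c s then Inr () else Inl a)" for b a
    have inj: "inj_on (g b) (c ` V)" for b
      unfolding g_def inj_on_def by auto
    have new: "g True (c u) \<notin> g False ` c ` V" if "c u = c s" for u
      using that unfolding g_def by auto
    have "(\<lambda>e. g (r \<in> e) (c (far_end e))) ` E \<subseteq> C <+> {()}"
      using colour_in[OF rooted_graph_axioms] unfolding g_def by auto
    with distinguishing_index_least[OF assms(1) distinguishing_star[OF c(1) inj repeated(1)
          new[OF refl] repeated(2) new[OF repeated(4)[symmetric]] repeated(3)]]
    show ?thesis
      unfolding bound[symmetric] by blast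
  next
    case infinite
    obtain r s t where rst: "{r, s} \<in> E" "{r, t} \<in> E" "s \<noteq> t"
      using vertex_of_degree_two_ex[OF assms] .
    interpret rooted_graph V E r
      using rst(1) by (rule rooted)
    \<comment> \<open>Two disjoint copies of \<open>C\<close> make every colour used at
      \<open>r\<close> exclusive to it; for infinite \<open>C\<close> the doubling costs
      nothing.\<close>
    define g :: "bool \<Rightarrow> 'a \<Rightarrow> 'a + 'a" where "g b = (if b then Inr else Inl)" for b
    have inj: "inj_on (g b) (c ` V)" for b
      unfolding g_def by simp
    have new: "g True (c u) \<notin> g False ` c ` V" for u
      unfolding g_def by auto
    have "(\<lambda>e. g (r \<in> e) (c (far_end e))) ` E \<subseteq> C <+> C"
      using colour_in[OF rooted_graph_axioms] unfolding g_def by auto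
    with distinguishing_index_least[OF assms(1) distinguishing_star[OF c(1) inj rst(1)
          new rst(2) new rst(3)]]
    have "distinguishing_index V E \<le>o |C <+> C|"
      by blast
    also have "|C <+> C| =o |C|"
      by (intro card_of_Plus_infinite1[OF infinite] card_of_mono1 subset_refl)
    also have "|C| \<le>o |C <+> {()}|"
      by (rule card_of_Plus1)
    finally (ordLeq_ordIso_trans ordLeq_transitive) show ?thesis
      unfolding bound .
  next
    case finite
    \<comment> \<open>With no colour repeated among the neighbours of \<open>v\<close>, they inject
      into the finite palette \<open>C\<close>.\<close>
    have fin: "finite {u. {v, u} \<in> E}" for v
    proof (rule inj_on_finite[OF finite(2) _ finite(1)])
      show "c ` {u. {v, u} \<in> E} \<subseteq> C"
        using c(2) simple_graph_edge[OF assms(1)] by blast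
    qed
    \<comment> \<open>This \<open>r\<close> only serves to find the ray; the colouring is rooted
      anew at \<open>p 0\<close>.\<close>
    obtain r s t where "{r, s} \<in> E" "{r, t} \<in> E" "s \<noteq> t"
      using vertex_of_degree_two_ex[OF assms] .
    then obtain p where p: "inj p" "\<And>n::nat. {p n, p (Suc n)} \<in> E"
      using rooted_graph.ray_ex[OF rooted assms(3) fin] by blast
    interpret rooted_graph V E "p 0"
      using p(2) by (rule rooted)
    have "(\<lambda>e. if e \<in> range (\<lambda>n. {p n, p (Suc n)}) then Inr () else Inl (c (far_end e))) ` E
      \<subseteq> C <+> {()}"
      using colour_in[OF rooted_graph_axioms] by auto
    with distinguishing_index_least[OF assms(1) distinguishing_ray[OF assms(1,2) p c(1)]]
    show ?thesis
      unfolding bound[symmetric] by blast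
  qed
qed

end
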